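(* For every $c\in\mathbb{N}$, reachability (on directed graphs) is in $\mathrm{DynFO}(\le,+,\times)$ under insertions of size $\log^c n$, i.e. the binary query returning all pairs $(s,t)$ such that there is a directed path from $s$ to $t$ can be maintained under changes that insert at most $\log^c n$ edges at a time (and delete none), where $n$ is the number of nodes.
   Context: Dynamic setting: the node set $V$ (of size $n$) is fixed; the input is a directed graph $(V,E)$, initially with $E=\emptyset$. A dynamic program keeps auxiliary relations on $V$, initially empty. After each change, each auxiliary relation $T$ is replaced by the set of tuples satisfying a fixed first-order update formula for $T$, evaluated on the changed input graph, the old auxiliary relations, and built-in relations $\le,+,\times$ (a linear order on $V$ identified with $\{0,\dots,n-1\}$ and the corresponding addition and multiplication relations). The query is maintained under changes of a given kind and size if a designated auxiliary relation equals the query result on the current graph after every non-empty sequence of such changes. $\mathrm{DynFO}(\le,+,\times)$ denotes the class of queries maintainable in this way. *)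

theory Defs
  imports Complex_Main
begin

text \<open>The node set of size \<open>n\<close> is \<open>{..<n}\<close>; node tuples are lists.\<close>

type_synonym graph = "(nat \<times> nat) set"

type_synonym query = "nat \<Rightarrow> graph \<Rightarrow> nat list set"

type_synonym aux_state = "nat \<Rightarrow> nat list set"

text \<open>First-order formulas over one binary input relation, the built-in relations
  \<open>\<le>\<close>, \<open>+\<close>, \<open>\<times>\<close> and auxiliary relations \<open>T\<^sub>0, T\<^sub>1, \<dots>\<close>.
  The vocabulary is purely relational, so the arguments of atoms are variables,
  which are natural numbers.\<close>

datatype fo =
    Eq nat nat
  | Leq nat nat
  | Plus nat nat nat
  | Times nat nat nat
  | Edge nat nat
  | Aux nat "nat list"
  | Neg fo
  | Conj fo fo
  | Exists nat fo

fun free_vars :: "fo \<Rightarrow> nat set" where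
  "free_vars (Eq x y) = {x, y}"
| "free_vars (Leq x y) = {x, y}"
| "free_vars (Plus x y z) = {x, y, z}"
| "free_vars (Times x y z) = {x, y, z}"
| "free_vars (Edge x y) = {x, y}"
| "free_vars (Aux i xs) = set xs"
| "free_vars (Neg \<phi>) = free_vars \<phi>"
| "free_vars (Conj \<phi> \<psi>) = free_vars \<phi> \<union> free_vars \<psi>"
| "free_vars (Exists x \<phi>) = free_vars \<phi> - {x}"

fun wf_fo :: "nat list \<Rightarrow> fo \<Rightarrow> bool" where
  "wf_fo arities (Aux i xs) \<longleftrightarrow> i < length arities \<and> length xs = arities ! i"
| "wf_fo arities (Neg \<phi>) \<longleftrightarrow> wf_fo arities \<phi>"
| "wf_fo arities (Conj \<phi> \<psi>) \<longleftrightarrow> wf_fo arities \<phi> \<and> wf_fo arities \<psi>"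
| "wf_fo arities (Exists x \<phi>) \<longleftrightarrow> wf_fo arities \<phi>"
| "wf_fo arities _ \<longleftrightarrow> True"

text \<open>Valuations take values in \<open>{..<n}\<close>, so \<open>Plus\<close> and \<open>Times\<close> denote the graphs of
  addition and multiplication restricted to \<open>{..<n}\<close>.\<close>

fun sat :: "nat \<Rightarrow> graph \<Rightarrow> aux_state \<Rightarrow> (nat \<Rightarrow> nat) \<Rightarrow> fo \<Rightarrow> bool" where
  "sat n E A v (Eq x y) \<longleftrightarrow> v x = v y"
| "sat n E A v (Leq x y) \<longleftrightarrow> v x \<le> v y"
| "sat n E A v (Plus x y z) \<longleftrightarrow> v x + v y = v z"
| "sat n E A v (Times x y z) \<longleftrightarrow> v x * v y = v z"
| "sat n E A v (Edge x y) \<longleftrightarrow> (v x, v y) \<in> E"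
| "sat n E A v (Aux i xs) \<longleftrightarrow> map v xs \<in> A i"
| "sat n E A v (Neg \<phi>) \<longleftrightarrow> \<not> sat n E A v \<phi>"
| "sat n E A v (Conj \<phi> \<psi>) \<longleftrightarrow> sat n E A v \<phi> \<and> sat n E A v \<psi>"
| "sat n E A v (Exists x \<phi>) \<longleftrightarrow> (\<exists>a<n. sat n E A (v(x := a)) \<phi>)"

text \<open>Entry \<open>i\<close> of a dynamic program is the arity of the auxiliary relation \<open>T\<^sub>i\<close> together
  with its update formula, whose free variables \<open>0, \<dots>, arity - 1\<close> stand for the components
  of the tuple.\<close>

type_synonym dyn_program = "(nat \<times> fo) list"

definition wf_program :: "dyn_program \<Rightarrow> bool" where
  "wf_program P \<longleftrightarrow> (\<forall>(k, \<phi>) \<in> set P. wf_fo (map fst P) \<phi> \<and> free_vars \<phi> \<subseteq> {..<k})"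

definition update_aux :: "nat \<Rightarrow> dyn_program \<Rightarrow> graph \<Rightarrow> aux_state \<Rightarrow> aux_state" where
  "update_aux n P E A i =
    (if i < length P
     then {a. length a = fst (P ! i) \<and> set a \<subseteq> {..<n} \<and> sat n E A (\<lambda>x. a ! x) (snd (P ! i))}
     else {})"

datatype change = Insert graph | Delete graph

fun apply_change :: "change \<Rightarrow> graph \<Rightarrow> graph" where
  "apply_change (Insert X) E = E \<union> X"
| "apply_change (Delete X) E = E - X"

text \<open>The update formulas are evaluated on the changed graph and the old auxiliary relations.\<close>

fun step :: "nat \<Rightarrow> dyn_program \<Rightarrow> graph \<times> aux_state \<Rightarrow> change \<Rightarrow> graph \<times> aux_state" where
  "step n P (E, A) d = (let E' = apply_change d E in (E', update_aux n P E' A))"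

definition run :: "nat \<Rightarrow> dyn_program \<Rightarrow> change list \<Rightarrow> graph \<times> aux_state" where
  "run n P ds = foldl (step n P) ({}, \<lambda>_. {}) ds"

text \<open>A kind of changes assigns to each \<open>n\<close> the admissible changes of graphs with \<open>n\<close> nodes.
  Elements of \<open>DynFO \<Delta>\<close> are queries paired with their arity. The program and the designated
  relation are chosen uniformly for all \<open>n\<close>.\<close>

definition DynFO :: "(nat \<Rightarrow> change set) \<Rightarrow> (nat \<times> query) set" where
  "DynFO \<Delta> = {(k, Q). \<exists>P q. wf_program P \<and> q < length P \<and> fst (P ! q) = k \<and>
     (\<forall>n ds. ds \<noteq> [] \<and> set ds \<subseteq> \<Delta> n \<longrightarrow>
        (case run n P ds of (E, A) \<Rightarrow> A q = Q n E))}"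

definition insertions :: "(nat \<Rightarrow> real) \<Rightarrow> nat \<Rightarrow> change set" where
  "insertions f n = {Insert X | X. X \<subseteq> {..<n} \<times> {..<n} \<and> real (card X) \<le> f n}"

text \<open>Paths may have length \<open>0\<close>, so every node reaches itself.\<close>

definition reachability :: query where
  "reachability n E = {[s, t] | s t. s < n \<and> t < n \<and> (s, t) \<in> E\<^sup>*}"

end

theory Submission
  imports Defs "HOL-Number_Theory.Cong" "HOL-Real_Asymp.Real_Asymp"
begin

text \<open>
  After an insertion, let \<open>N\<close> be the set of edges not contained in the old reachability relation
  and \<open>S\<close> the set of their sources, which has polylogarithmic size. A path in the new graph is an
  old path or consists of an old path into \<open>S\<close>, hops within \<open>S\<close> (a new edge followed by an old
  path), and a final new edge followed by an old path, so it remains to define the transitive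
  closure of the hop relation on the small set \<open>S\<close>.

  Nodes of \<open>S\<close> are named by their residues modulo a number \<open>q\<close> that is injective on \<open>S\<close>; since
  \<open>lcm(1,\<dots>,Q)\<close> grows exponentially, it cannot divide the product of all differences
  of elements of \<open>S\<close> for a suitable polylogarithmic \<open>Q\<close>, so some \<open>q \<le> Q\<close> works. A sequence of
  about \<open>(log n)\<^bsup>1/4\<^esup>\<close> such names is coded by a single number below \<open>n\<close> via Goedel's beta function,
  which needs only addition and multiplication. Guessing such a sequence contracts paths of that
  length to single edges, so constantly many iterations cover all paths in \<open>S\<close>. The coded paths
  are sound without any size bounds; these matter only for completeness.
\<close>

section \<open>Injective residues\<close>

text \<open>In Leibniz' harmonic triangle \<open>L n m = 1 / (m * (n choose m))\<close>, the recurrence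
  \<open>L n (m + 1) = L (n - 1) m - L n m\<close> makes every entry an integer combination of the
  numbers \<open>1 / j\<close> with \<open>j \<le> n\<close>.\<close>

lemma mult_binomial_dvd:
  fixes N :: nat
  assumes "\<And>j. 1 \<le> j \<Longrightarrow> j \<le> n \<Longrightarrow> j dvd N" "1 \<le> m" "m \<le> n"
  shows "m * (n choose m) dvd N"
proof -
  have "\<forall>n. m \<le> n \<longrightarrow> (\<forall>j. 1 \<le> j \<and> j \<le> n \<longrightarrow> j dvd N) \<longrightarrow>
      (real N / real (m * (n choose m))) \<in> \<int>" if "1 \<le> m" for m
    using that
  proof (induction m rule: dec_induct)
    case base
    show ?case
      by (auto simp: dvd_def)
  next
    case (step m)
    show ?case
    proof (intro allI impI)
      fix n assume n: "Suc m \<le> n" and dvd: "\<forall>j. 1 \<le> j \<and> j \<le> n \<longrightarrow> j dvd N"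
      then obtain n' where n': "n = Suc n'" by (cases n) auto
      have 1: "real N / real (m * (n' choose m)) \<in> \<int>" "real N / real (m * (n choose m)) \<in> \<int>"
        using step.IH n dvd n' by auto
      define a where "a = n' choose m"
      have pos: "0 < a" "0 < m" using n n' step.hyps by (auto simp: a_def)
      have c2: "Suc m * (n choose Suc m) = Suc n' * a"
        unfolding n' a_def using Suc_times_binomial_eq[of n' m] by simp
      have c3: "(n - m) * (n choose m) = Suc n' * a"
        unfolding n' a_def
        using binomial_absorb_comp[of "Suc n'" m] by simp
      have r: "real (Suc m * (n choose Suc m)) = real (Suc n' * a)" using c2 by presburger
      have c3r: "(real n - real m) * real (n choose m) = (real n' + 1) * real a"
        using arg_cong[OF c3, of real] n by (simp add: algebra_simps)
      have "real N / real (Suc m * (n choose Suc m)) =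
          real N / real (m * (n' choose m)) - real N / real (m * (n choose m))"
      proof -
        have x: "real (n choose m) = (real n' + 1) * real a / (real n - real m)"
          using c3r n by (simp add: field_simps)
        have nz: "real n - real m \<noteq> 0" "real n' + 1 \<noteq> 0" using n by auto
        show ?thesis
          unfolding r unfolding a_def[symmetric] of_nat_mult x
          using pos nz by (simp add: divide_simps n') (simp add: algebra_simps)
      qed
      then show "real N / real (Suc m * (n choose Suc m)) \<in> \<int>"
        using 1 by simp
    qed
  qed
  then have "real N / real (m * (n choose m)) \<in> \<int>"
    using assms by auto
  then obtain z where z: "real N / real (m * (n choose m)) = of_int z" by (auto elim: Ints_cases)
  have pos: "0 < m * (n choose m)" using assms by simp
  have "real N = real_of_int (z * int (m * (n choose m)))"
    using z pos by (simp add: field_simps)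
  then have "int N = z * int (m * (n choose m))"
    by linarith
  then show ?thesis
    by (metis dvd_triv_right int_dvd_int_iff)
qed

text \<open>If every \<open>q\<close> up to \<open>2 * M\<close> identified two elements of
  \<open>S\<close>, each would divide the product \<open>D\<close> of the positive differences, and
  hence so would \<open>M * (2 * M choose M)\<close>, which is at least \<open>2 ^ M\<close>. But
  \<open>D\<close> has at most \<open>(card S)\<^sup>2\<close> factors, each at most
  \<open>n\<close>.\<close>

lemma ex_inj_on_mod:
  fixes S :: "nat set"
  assumes S: "S \<subseteq> {..<n}" and M: "n ^ (card S)\<^sup>2 < 2 ^ M"
  shows "\<exists>q. 0 < q \<and> q \<le> 2 * M \<and> inj_on (\<lambda>u. u mod q) S"
proof (rule ccontr)
  assume contra: "\<not> ?thesis"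
  have fin: "finite S" using S finite_subset by blast
  define Z where "Z = {(x, y). x \<in> S \<and> y \<in> S \<and> x < y}"
  have Z: "Z \<subseteq> S \<times> S" by (auto simp: Z_def)
  then have finZ: "finite Z" using fin finite_subset by blast
  define D where "D = (\<Prod>(x, y)\<in>Z. y - x)"
  have "D > 0" unfolding D_def by (rule prod_pos) (auto simp: Z_def)
  have "q dvd D" if q: "1 \<le> q" "q \<le> 2 * M" for q
  proof -
    obtain x y where "x \<in> S" "y \<in> S" "x \<noteq> y" "x mod q = y mod q"
      using contra q by (auto simp: inj_on_def)
    then obtain x y where xy: "x \<in> S" "y \<in> S" "x < y" "y mod q = x mod q"
      by (metis linorder_neqE_nat)
    then have "q dvd y - x" by (simp add: mod_eq_dvd_iff_nat)
    also have "y - x dvd D"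
      unfolding D_def using dvd_prodI[OF finZ, of "(x, y)" "\<lambda>(x, y). y - x"] xy
      by (auto simp: Z_def)
    finally show ?thesis .
  qed
  moreover have "1 \<le> M"
  proof (rule ccontr)
    assume "\<not> 1 \<le> M"
    then have "n ^ (card S)\<^sup>2 = 0" using M by (simp add: not_le)
    then have "n = 0" "card S \<noteq> 0" by auto
    then show False using S by simp
  qed
  ultimately have "M * (2 * M choose M) dvd D"
    by (intro mult_binomial_dvd) auto
  then have "M * (2 * M choose M) \<le> D"
    using \<open>D > 0\<close> by (rule dvd_imp_le)
  moreover have "2 ^ M \<le> 2 * M choose M"
  proof -
    have "2 ^ M = (\<Prod>i<M. (2::real))" by simp
    also have "\<dots> = (real (2 * M) / real M) ^ M" using \<open>1 \<le> M\<close> by simp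
    also have "\<dots> \<le> real (2 * M choose M)" by (rule binomial_ge_n_over_k_pow_k) simp
    finally show ?thesis
      by (metis of_nat_le_iff of_nat_numeral of_nat_power)
  qed
  moreover have "2 * M choose M \<le> M * (2 * M choose M)" using \<open>1 \<le> M\<close> by simp
  moreover have "D \<le> n ^ (card S)\<^sup>2"
  proof -
    have "D \<le> (\<Prod>p\<in>Z. n)"
      unfolding D_def using S by (intro prod_mono) (auto simp: Z_def)
    also have "\<dots> = n ^ card Z" by simp
    also have "\<dots> \<le> n ^ (card S)\<^sup>2"
    \<comment> \<open>For \<open>n = 0\<close> the power is not monotone in the exponent; there both
      exponents are 0 and \<open>0 ^ 0 = 1\<close>.\<close>
    proof (cases "n = 0")
      case True
      then have "S = {}" using S by simp
      then show ?thesis using Z by simp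
    next
      case False
      moreover have "card Z \<le> (card S)\<^sup>2"
        using card_mono[OF _ Z] fin by (simp add: card_cartesian_product power2_eq_square)
      ultimately show ?thesis by (simp add: power_increasing)
    qed
    finally show ?thesis .
  qed
  ultimately show False using M by linarith
qed

section \<open>Paths coded by a single number\<close>

text \<open>The number \<open>a\<close> codes the sequence of residues \<open>a mod (m + i * b)\<close>, \<open>i \<le> k\<close>, each of which
  names the node of \<open>S\<close> with that residue modulo \<open>q\<close>.\<close>

definition coded_step :: "nat \<Rightarrow> nat set \<Rightarrow> (nat \<times> nat) set \<Rightarrow> (nat \<times> nat) set" where
  "coded_step n S R = {(x, y). x \<in> S \<and> y \<in> S \<and>
     (\<exists>q<n. \<exists>a<n. \<exists>b<n. \<exists>m<n. \<exists>k<n. 0 < q \<and> inj_on (\<lambda>u. u mod q) S \<and> 0 < m \<and> m + k * b < n \<and>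
        x mod q = a mod m \<and> y mod q = a mod (m + k * b) \<and>
        (\<forall>i<k. \<exists>u v. (u, v) \<in> R \<and>
           u mod q = a mod (m + i * b) \<and> v mod q = a mod (m + i * b + b)))}"

text \<open>The head of the edge guessed at one index and the tail of the edge guessed at the next
  have equal names; as names are injective on \<open>S\<close>, they are the same node, so the edges
  join up.\<close>

lemma coded_step_sound:
  assumes R: "R \<subseteq> S \<times> S"
  shows "coded_step n S R \<subseteq> R\<^sup>*"
proof clarify
  fix x y assume "(x, y) \<in> coded_step n S R"
  then obtain q a b m k where xy: "x \<in> S" "y \<in> S" and inj: "inj_on (\<lambda>u. u mod q) S"
    and x: "x mod q = a mod m" and y: "y mod q = a mod (m + k * b)"
    and step: "\<And>i. i < k \<Longrightarrow> \<exists>u v. (u, v) \<in> R \<and>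
           u mod q = a mod (m + i * b) \<and> v mod q = a mod (m + i * b + b)"
    unfolding coded_step_def by blast
  have "\<exists>w\<in>S. w mod q = a mod (m + i * b) \<and> (x, w) \<in> R\<^sup>*" if "i \<le> k" for i
    using that
  proof (induction i)
    case 0
    then show ?case using x xy by auto
  next
    case (Suc i)
    then obtain w where w: "w \<in> S" "w mod q = a mod (m + i * b)" "(x, w) \<in> R\<^sup>*" by auto
    obtain u v where uv: "(u, v) \<in> R"
      "u mod q = a mod (m + i * b)" "v mod q = a mod (m + i * b + b)"
      using step[of i] Suc.prems by auto
    have "u = w" using inj_onD[OF inj, of u w] uv w R by auto
    then have "(x, v) \<in> R\<^sup>*" using w uv by auto
    moreover have "v mod q = a mod (m + Suc i * b)" using uv(3) by (simp add: ac_simps)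
    ultimately show ?case using uv(1) R by (intro bexI[of _ v]) auto
  qed
  then obtain w where w: "w \<in> S" "w mod q = a mod (m + k * b)" "(x, w) \<in> R\<^sup>*" by blast
  then have "w = y" using inj_onD[OF inj, of w y] y xy by auto
  then show "(x, y) \<in> R\<^sup>*" using w by simp
qed

text \<open>A common divisor divides \<open>(j - i) * b\<close> and therefore \<open>b * b\<close>,
  because \<open>j - i\<close> divides \<open>fact K\<close>. It is also coprime to
  \<open>b\<close>, since it divides a number congruent to 1 modulo \<open>b\<close>.\<close>

lemma coprime_beta_moduli:
  fixes b :: nat
  assumes "fact K dvd b" "i \<le> K" "j \<le> K" "i \<noteq> j"
  shows "coprime (1 + (i + 1) * b) (1 + (j + 1) * b)"
proof -
  have *: "coprime (1 + (i + 1) * b) (1 + (j + 1) * b)" if "i < j" "j \<le> K" for i j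
  proof (rule coprimeI)
    fix d assume d: "d dvd 1 + (i + 1) * b" "d dvd 1 + (j + 1) * b"
    have "d dvd (1 + (j + 1) * b) - (1 + (i + 1) * b)" by (rule dvd_diff_nat[OF d(2,1)])
    moreover have "(1 + (j + 1) * b) - (1 + (i + 1) * b) = (j - i) * b"
      using that by (simp add: diff_mult_distrib)
    moreover have "j - i dvd b"
      using that assms(1) dvd_fact[of "j - i" K] by (auto intro: dvd_trans)
    ultimately have "d dvd b * b" by (metis dvd_refl dvd_trans mult_dvd_mono)
    moreover have "coprime d b"
    proof (rule coprimeI)
      fix e assume "e dvd d" "e dvd b"
      then have "e dvd 1 + (i + 1) * b" "e dvd (i + 1) * b" using d by (auto intro: dvd_trans)
      then show "is_unit e" by (metis dvd_add_left_iff)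
    qed
    ultimately show "is_unit d"
      by (metis coprime_common_divisor coprime_mult_right_iff dvd_refl)
  qed
  show ?thesis
    using *[of i j] *[of j i] assms by (cases "i < j") (auto simp: coprime_commute)
qed

text \<open>The Chinese remainder theorem supplies a code for the names along the path. Each name is
  smaller than its modulus and so is recovered exactly; \<open>bound\<close> keeps all guessed
  numbers below \<open>n\<close>.\<close>

lemma coded_step_complete:
  assumes S: "S \<subseteq> {..<n}" and R: "R \<subseteq> S \<times> S" and x: "x \<in> S"
    and q: "0 < q" "inj_on (\<lambda>u. u mod q) S" and xy: "(x, y) \<in> R ^^ K"
    and bound: "(1 + (K + 1) * (fact K * q)) ^ (K + 1) < n"
  shows "(x, y) \<in> coded_step n S R"
proof -
  obtain f where f: "f 0 = x" "f K = y" "\<And>i. i < K \<Longrightarrow> (f i, f (Suc i)) \<in> R"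
    using xy by (auto simp: relpow_fun_conv)
  have fS: "f i \<in> S" if "i \<le> K" for i
    using that f(1) x R f(3)[of "i - 1"] by (cases i) auto
  \<comment> \<open>The factor \<open>fact K\<close> makes the moduli coprime, the factor
    \<open>q\<close> makes them exceed \<open>q\<close>.\<close>
  define b :: nat where "b = fact K * q"
  define M where "M i = 1 + (i + 1) * b" for i
  have b: "q \<le> b" unfolding b_def by simp
  have "coprime (M i) (M j)" if "i \<le> K" "j \<le> K" "i \<noteq> j" for i j
    unfolding M_def using that by (intro coprime_beta_moduli) (auto simp: b_def)
  then have "\<exists>!a. a < (\<Prod>i\<in>{..K}. M i) \<and> (\<forall>i\<in>{..K}. [a = f i mod q] (mod M i))"
    by (intro chinese_remainder_unique_nat) (auto simp: M_def)
  then obtain a where a: "a < (\<Prod>i\<in>{..K}. M i)" "\<And>i. i \<le> K \<Longrightarrow> [a = f i mod q] (mod M i)"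
    by auto
  have code: "f i mod q = a mod M i" if "i \<le> K" for i
  proof -
    have "f i mod q < q" using q(1) by simp
    also have "b < M i" by (simp add: M_def)
    then have "q < M i" using b by linarith
    finally have "f i mod q < M i" .
    then have "f i mod q mod M i = f i mod q" by (rule mod_less)
    moreover have "a mod M i = f i mod q mod M i"
      using a(2)[OF that] unfolding unique_euclidean_semiring_class.cong_def .
    ultimately show ?thesis by argo
  qed
  have "(\<Prod>i\<in>{..K}. M i) \<le> (\<Prod>i\<in>{..K}. M K)"
    by (intro prod_mono) (auto simp: M_def)
  also have "\<dots> = M K ^ (K + 1)" by simp
  also have lt: "\<dots> < n" using bound by (simp add: M_def b_def)
  finally have "a < n" using a by simp
  have "M K \<le> M K ^ (K + 1)" by (rule self_le_power) (auto simp: M_def)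
  then have MK: "M K < n" using lt by linarith
  \<comment> \<open>With \<open>M 0\<close> as \<open>m\<close>, the moduli form the progression
    that \<open>coded_step\<close> asks for.\<close>
  have M: "M 0 + i * b = M i" "M i + b = M (Suc i)" for i by (auto simp: M_def)
  have "b \<le> (K + 1) * b" by simp
  then have bM: "b < M K" by (simp add: M_def)
  have "K + 1 \<le> (K + 1) * b" using b q(1) mult_le_mono2[of 1 b "K + 1"] by simp
  then have KM: "K < M K" by (simp add: M_def)
  have "M 0 \<le> M K" by (simp add: M_def)
  then have "q < n" "a < n" "b < n" "M 0 < n" "K < n"
    using bM KM b MK \<open>a < n\<close> by linarith+
  moreover have "\<forall>i<K. \<exists>u v. (u, v) \<in> R \<and> u mod q = a mod (M 0 + i * b) \<and> v mod q = a mod (M 0 + i * b + b)"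
    unfolding M using f(3) code by (metis Suc_leI less_imp_le_nat)
  moreover have "0 < M 0" by (simp add: M_def)
  moreover have "x mod q = a mod M 0" "y mod q = a mod (M 0 + K * b)" "M 0 + K * b < n"
    using code[of 0] code[of K] f MK M(1) by auto
  moreover have "y \<in> S" using fS f by auto
  ultimately show ?thesis
    unfolding coded_step_def mem_Collect_eq prod.case using x q
    by (intro conjI exI[of _ q] exI[of _ a] exI[of _ b] exI[of _ "M 0"] exI[of _ K])
qed

section \<open>Iterating coded paths\<close>

text \<open>The summand \<open>R' O R'\<close> is needed only for the finitely many \<open>n\<close> that are too small for coded
  paths to be useful: there \<open>2\<^sup>d\<close> exceeds the length of all paths.\<close>

fun iter_rel :: "nat \<Rightarrow> nat set \<Rightarrow> (nat \<times> nat) set \<Rightarrow> nat \<Rightarrow> (nat \<times> nat) set" where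
  "iter_rel n S R 0 = R"
| "iter_rel n S R (Suc d) =
     (let R' = iter_rel n S R d in R' O R' \<union> coded_step n S R')"

lemma iter_rel_subset:
  assumes "R \<subseteq> S \<times> S" shows "iter_rel n S R d \<subseteq> S \<times> S"
  using assms by (induction d) (auto simp: Let_def coded_step_def)

lemma iter_rel_sound:
  assumes "R \<subseteq> S \<times> S" shows "iter_rel n S R d \<subseteq> R\<^sup>*"
proof (induction d)
  case (Suc d)
  have "coded_step n S (iter_rel n S R d) \<subseteq> (iter_rel n S R d)\<^sup>*"
    by (rule coded_step_sound[OF iter_rel_subset[OF assms]])
  also have "\<dots> \<subseteq> R\<^sup>*" using Suc by (simp add: rtrancl_subset_rtrancl)
  finally show ?case using Suc by (auto simp: Let_def intro: rtrancl_trans)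
qed auto

lemma relpow_mult_subset:
  fixes R :: "('a \<times> 'a) set"
  assumes "R ^^ l \<subseteq> Q" shows "R ^^ (k * l) \<subseteq> Q ^^ k"
proof (induction k)
  case (Suc k)
  have "R ^^ (Suc k * l) = R ^^ (k * l) O R ^^ l"
    by (simp add: relpow_add[symmetric] add.commute)
  then show ?case using Suc assms by (auto simp: relcomp_mono)
qed simp

text \<open>By the first assumption one round contracts any \<open>K\<close> consecutive edges to
  one, so each round multiplies the covered length by \<open>K\<close>.\<close>

lemma iter_rel_power:
  assumes "\<And>R' x y. R' \<subseteq> S \<times> S \<Longrightarrow> (x, y) \<in> R' ^^ K \<Longrightarrow> x \<in> S \<Longrightarrow> (x, y) \<in> R' O R' \<union> coded_step n S R'"
    and R: "R \<subseteq> S \<times> S" and K: "1 \<le> K"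
  shows "R ^^ (K ^ d) \<subseteq> iter_rel n S R d"
proof (induction d)
  case (Suc d)
  have "R ^^ (K ^ Suc d) \<subseteq> iter_rel n S R d ^^ K"
    using relpow_mult_subset[OF Suc, of K] by simp
  moreover have "(x, y) \<in> iter_rel n S R (Suc d)" if "(x, y) \<in> iter_rel n S R d ^^ K" for x y
  proof -
    have "x \<in> S" using that K iter_rel_subset[OF R, of n d]
      by (cases K) (auto dest!: relpow_Suc_D2 simp del: relpow.simps(2))
    then show ?thesis using assms(1)[OF iter_rel_subset[OF R] that] by (simp add: Let_def)
  qed
  ultimately show ?case by auto
qed simp

text \<open>Some path has at most \<open>card R\<close> edges; loops at its last node pad it to
  exactly \<open>K ^ d\<close> edges, the length that \<open>iter_rel_power\<close> handles.\<close>

lemma iter_rel_complete: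
  assumes "\<And>R' x y. R' \<subseteq> S \<times> S \<Longrightarrow> (x, y) \<in> R' ^^ K \<Longrightarrow> x \<in> S \<Longrightarrow> (x, y) \<in> R' O R' \<union> coded_step n S R'"
    and R: "R \<subseteq> S \<times> S" and K: "1 \<le> K" and fin: "finite S" and refl: "Id_on S \<subseteq> R"
    and d: "(card S)\<^sup>2 \<le> K ^ d" and xy: "(x, y) \<in> R\<^sup>*" "x \<in> S"
  shows "(x, y) \<in> iter_rel n S R d"
proof -
  have "finite R" using R fin finite_subset by blast
  moreover have "card R \<le> (card S)\<^sup>2"
    using card_mono[OF _ R] fin by (simp add: card_cartesian_product power2_eq_square)
  ultimately obtain l where l: "l \<le> K ^ d" "(x, y) \<in> R ^^ l"
    using xy(1) d by (auto simp: rtrancl_finite_eq_relpow dest: order_trans)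
  have yS: "y \<in> S" using xy R by (auto elim: rtranclE)
  have yy: "(y, y) \<in> R ^^ j" for j
    by (induction j) (use refl yS in auto)
  have "(x, y) \<in> R ^^ (l + (K ^ d - l))"
    by (rule relpow_trans[OF l(2) yy])
  then have "(x, y) \<in> R ^^ (K ^ d)" using l by simp
  then show ?thesis using iter_rel_power[OF assms(1) R K] by blast
qed

section \<open>Asymptotics of the code length\<close>

lemma powr_mult_log:
  fixes x :: real
  assumes "0 < x" shows "2 powr (real m * log 2 x) = x ^ m"
proof -
  have "2 powr (real m * log 2 x) = (2 powr log 2 x) powr real m"
    unfolding powr_powr by (simp only: mult.commute)
  then show ?thesis using assms by (simp add: powr_realpow)
qed

text \<open>For \<open>l = log 2 n\<close> and \<open>K\<close> about \<open>l powr (1/4)\<close>,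
  the logarithm of the last power has order at most \<open>sqrt l * log 2 l\<close>, eventually
  below \<open>l\<close>. Rounding \<open>K\<close> down still leaves
  \<open>K \<ge> l powr (1/8)\<close>, whence the exponent \<open>16 * c\<close>. The range of
  \<open>q\<close> is what \<open>ex_inj_on_mod\<close> yields for sets of size at most
  \<open>l ^ c\<close>.\<close>

lemma ex_code_length:
  fixes c :: nat
  shows "\<exists>N. \<forall>n\<ge>N. \<exists>K\<ge>1. log 2 (real n) ^ (2 * c) \<le> real K ^ (16 * c) \<and>
    (\<forall>q. real q \<le> 2 * log 2 (real n) ^ (2 * c + 1) + 2 \<longrightarrow>
       (1 + (K + 1) * (fact K * q)) ^ (K + 1) < n)"
proof -
  define K where "K n = nat \<lfloor>log 2 (real n) powr (1/4)\<rfloor>" for n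
  \<comment> \<open>An upper bound for the logarithm of the power, with \<open>K\<close> replaced by
    its upper bound \<open>l powr (1/4)\<close>.\<close>
  let ?B = "\<lambda>l::real. (l powr (1/4) + 1) * (2 + (l powr (1/4) + 1) * log 2 (l powr (1/4) + 1) + log 2 3 + (2 * c + 1) * log 2 l)"
  have log: "filterlim (\<lambda>n. log 2 (real n)) at_top sequentially"
    by real_asymp
  have 1: "eventually (\<lambda>l::real. ?B l < l) at_top"
    by real_asymp
  have 2: "eventually (\<lambda>l::real. l powr (1/8) \<le> l powr (1/4) - 1) at_top"
    by real_asymp
  have 3: "eventually (\<lambda>l::real. 2 \<le> l) at_top"
    by real_asymp
  have "eventually (\<lambda>n. ?B (log 2 (real n)) < log 2 (real n) \<and>
      log 2 (real n) powr (1/8) \<le> log 2 (real n) powr (1/4) - 1 \<and> 2 \<le> log 2 (real n)) sequentially"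
    by (intro eventually_conj filterlim_compose[OF _ log, unfolded filterlim_iff]
      log[unfolded filterlim_iff, rule_format] 1 2 3)
  then obtain N where N: "\<And>n. n \<ge> N \<Longrightarrow> ?B (log 2 (real n)) < log 2 (real n) \<and>
      log 2 (real n) powr (1/8) \<le> log 2 (real n) powr (1/4) - 1 \<and> 2 \<le> log 2 (real n)"
    by (auto simp: eventually_sequentially)
  show ?thesis
  proof (rule exI[of _ N], intro allI impI)
    fix n assume n: "N \<le> n"
    define l where "l = log 2 (real n)"
    have B: "?B l < l" and l8: "l powr (1/8) \<le> l powr (1/4) - 1" and l2: "2 \<le> l"
      using N[OF n] by (auto simp: l_def)
    have "n \<noteq> 0" using l2 by (intro notI) (simp add: l_def log_def)
    then have n_eq: "real n = 2 powr l" by (simp add: l_def)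
    define k where "k = K n"
    have "1 \<le> l powr (1/8)" using l2 by (simp add: ge_one_powr_ge_zero)
    have k_le: "real k \<le> l powr (1/4)" unfolding k_def K_def l_def[symmetric] by simp
    have "l powr (1/4) - 1 \<le> real k" unfolding k_def K_def l_def[symmetric] by linarith
    then have k_ge: "l powr (1/8) \<le> real k" using l8 by simp
    then have k1: "1 \<le> k" using \<open>1 \<le> l powr (1/8)\<close> by simp
    have "l ^ (2 * c) = (l powr (1/8)) ^ (16 * c)"
      using l2 by (simp add: powr_realpow[symmetric] powr_powr)
    also have "\<dots> \<le> real k ^ (16 * c)" using k_ge by (intro power_mono) auto
    finally have part1: "l ^ (2 * c) \<le> real k ^ (16 * c)" .
    have part2: "(1 + (k + 1) * (fact k * q)) ^ (k + 1) < n" if q: "real q \<le> 2 * l ^ (2 * c + 1) + 2" for q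
    proof -
      have l1: "1 \<le> l ^ (2 * c + 1)" using l2 by (intro one_le_power) simp
      have f: "real (fact (k + 1)) \<le> real (k + 1) ^ (k + 1)"
        using fact_le_power[of "k + 1", where 'a = real] by (metis of_nat_fact of_nat_power)
      have f1: "1 \<le> real (k + 1) ^ (k + 1)" by (intro one_le_power) simp
      have "real (1 + (k + 1) * (fact k * q)) = 1 + real (fact (k + 1)) * real q"
        by (simp add: algebra_simps)
      also have "\<dots> \<le> 1 + real (k + 1) ^ (k + 1) * (2 * l ^ (2 * c + 1) + 2)"
        using f q by (intro add_left_mono mult_mono) auto
      also have "\<dots> \<le> real (k + 1) ^ (k + 1) * (2 * l ^ (2 * c + 1) + 3)"
        using f1 by (simp add: algebra_simps)
      \<comment> \<open>The constant \<open>4 * 3\<close> becomes the summands \<open>2\<close> and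
        \<open>log 2 3\<close> of the exponent.\<close>
      also have "\<dots> \<le> real (k + 1) ^ (k + 1) * (4 * 3 * l ^ (2 * c + 1))"
        using l1 f1 by (intro mult_left_mono) auto
      also have "\<dots> = 2 powr (2 + (k + 1) * log 2 (k + 1) + log 2 3 + (2 * c + 1) * log 2 l)"
      proof -
        have "2 powr ((k + 1) * log 2 (k + 1)) = real (k + 1) ^ (k + 1)"
          by (rule powr_mult_log) simp
        moreover have "2 powr ((2 * c + 1) * log 2 l) = l ^ (2 * c + 1)"
          using l2 by (intro powr_mult_log) simp
        ultimately show ?thesis by (simp add: powr_add)
      qed
      finally have base: "real (1 + (k + 1) * (fact k * q)) \<le>
        2 powr (2 + (k + 1) * log 2 (k + 1) + log 2 3 + (2 * c + 1) * log 2 l)" .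
      let ?e = "2 + (k + 1) * log 2 (k + 1) + log 2 3 + (2 * c + 1) * log 2 l"
      have "real ((1 + (k + 1) * (fact k * q)) ^ (k + 1)) \<le> (2 powr ?e) ^ (k + 1)"
        unfolding of_nat_power by (rule power_mono[OF base]) simp
      also have "\<dots> = 2 powr ((k + 1) * ?e)"
        by (simp only: powr_realpow[symmetric] powr_gt_zero powr_powr) (simp add: mult.commute)
      also have "\<dots> < 2 powr l"
      proof -
        have "(k + 1) * ?e \<le> ?B l"
          using k_le l2 by (intro mult_mono add_mono) auto
        then show ?thesis using B by simp
      qed
      finally show ?thesis using n_eq of_nat_less_iff by metis
    qed
    show "\<exists>K\<ge>1. log 2 (real n) ^ (2 * c) \<le> real K ^ (16 * c) \<and>
    (\<forall>q. real q \<le> 2 * log 2 (real n) ^ (2 * c + 1) + 2 \<longrightarrow>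
       (1 + (K + 1) * (fact K * q)) ^ (K + 1) < n)"
      using k1 part1 part2 unfolding l_def by blast
  qed
qed


section \<open>Reachability after an insertion\<close>

text \<open>The loops \<open>u = u'\<close> provide the padding used in
  \<open>iter_rel_complete\<close>.\<close>

definition hop :: "(nat \<times> nat) set \<Rightarrow> (nat \<times> nat) set \<Rightarrow> (nat \<times> nat) set" where
  "hop T N = {(u, u'). u \<in> Domain N \<and> u' \<in> Domain N \<and>
     (u = u' \<or> (\<exists>v. (u, v) \<in> N \<and> (v, u') \<in> T))}"

text \<open>Cut a path at its edges outside \<open>E\<^sup>*\<close>: from the source of one such
  edge to the source of the next lead a new edge and an old path, that is, a hop.\<close>

lemma rtrancl_insertion_iff:
  assumes "E \<subseteq> E'" "N \<subseteq> E'" "E' \<subseteq> E\<^sup>* \<union> N"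
  shows "(s, t) \<in> E'\<^sup>* \<longleftrightarrow> (s, t) \<in> E\<^sup>* \<or>
    (\<exists>u u' v. (s, u) \<in> E\<^sup>* \<and> (u, u') \<in> (hop (E\<^sup>*) N)\<^sup>* \<and> (u', v) \<in> N \<and> (v, t) \<in> E\<^sup>*)"
    (is "_ \<longleftrightarrow> ?R s t")
proof
  assume "(s, t) \<in> E'\<^sup>*"
  then show "?R s t"
  proof induction
    case (step t t')
    show ?case
    proof (cases "(t, t') \<in> E\<^sup>*")
      case True
      then show ?thesis using step.IH by (meson rtrancl_trans)
    next
      case False
      then have N: "(t, t') \<in> N" using step.hyps assms by auto
      from step.IH show ?thesis
      proof (elim disjE exE conjE)
        assume "(s, t) \<in> E\<^sup>*"
        then show ?thesis using N by blast
      next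
        fix u u' v
        assume h: "(s, u) \<in> E\<^sup>*" "(u, u') \<in> (hop (E\<^sup>*) N)\<^sup>*" "(u', v) \<in> N" "(v, t) \<in> E\<^sup>*"
        then have "(u', t) \<in> hop (E\<^sup>*) N" using N by (auto simp: hop_def)
        then have "(u, t) \<in> (hop (E\<^sup>*) N)\<^sup>*" using h by simp
        then show ?thesis using h N by blast
      qed
    qed
  qed simp
next
  have E: "E\<^sup>* \<subseteq> E'\<^sup>*" using assms rtrancl_mono by blast
  have "hop (E\<^sup>*) N \<subseteq> E'\<^sup>*"
    using E assms by (auto simp: hop_def intro: converse_rtrancl_into_rtrancl)
  then have "(hop (E\<^sup>*) N)\<^sup>* \<subseteq> E'\<^sup>*" by (simp add: rtrancl_subset_rtrancl)
  then show "?R s t \<Longrightarrow> (s, t) \<in> E'\<^sup>*"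
    using E assms by (meson rtrancl_trans r_into_rtrancl subsetD)
qed

section \<open>The update formula\<close>

definition Disj :: "fo \<Rightarrow> fo \<Rightarrow> fo" where
  "Disj \<phi> \<psi> = Neg (Conj (Neg \<phi>) (Neg \<psi>))"

definition Imp :: "fo \<Rightarrow> fo \<Rightarrow> fo" where
  "Imp \<phi> \<psi> = Neg (Conj \<phi> (Neg \<psi>))"

definition Forall :: "nat \<Rightarrow> fo \<Rightarrow> fo" where
  "Forall x \<phi> = Neg (Exists x (Neg \<phi>))"

lemma sat_derived [simp]:
  "sat n E A v (Disj \<phi> \<psi>) \<longleftrightarrow> sat n E A v \<phi> \<or> sat n E A v \<psi>"
  "sat n E A v (Imp \<phi> \<psi>) \<longleftrightarrow> (sat n E A v \<phi> \<longrightarrow> sat n E A v \<psi>)"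
  "sat n E A v (Forall x \<phi>) \<longleftrightarrow> (\<forall>a<n. sat n E A (v(x := a)) \<phi>)"
  by (auto simp: Disj_def Imp_def Forall_def)

lemma syntax_derived [simp]:
  "free_vars (Disj \<phi> \<psi>) = free_vars \<phi> \<union> free_vars \<psi>"
  "free_vars (Imp \<phi> \<psi>) = free_vars \<phi> \<union> free_vars \<psi>"
  "free_vars (Forall x \<phi>) = free_vars \<phi> - {x}"
  "wf_fo ks (Disj \<phi> \<psi>) \<longleftrightarrow> wf_fo ks \<phi> \<and> wf_fo ks \<psi>"
  "wf_fo ks (Imp \<phi> \<psi>) \<longleftrightarrow> wf_fo ks \<phi> \<and> wf_fo ks \<psi>"
  "wf_fo ks (Forall x \<phi>) \<longleftrightarrow> wf_fo ks \<phi>"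
  by (auto simp: Disj_def Imp_def Forall_def)

text \<open>Adding the diagonal makes the initially empty relation correct for the empty graph, and
  matches \<open>E\<^sup>*\<close>, which is reflexive on all of \<open>nat\<close>.\<close>

definition old_reach :: "aux_state \<Rightarrow> (nat \<times> nat) set" where
  "old_reach A = {(x, y). x = y \<or> [x, y] \<in> A 0}"

definition old_reach_fo :: "nat \<Rightarrow> nat \<Rightarrow> fo" where
  "old_reach_fo x y = Disj (Eq x y) (Aux 0 [x, y])"

definition new_fo :: "nat \<Rightarrow> nat \<Rightarrow> fo" where
  "new_fo x y = Conj (Edge x y) (Neg (old_reach_fo x y))"

text \<open>Variables \<open>20\<close> and \<open>21\<close> are bound only here and in
  \<open>mod_fo\<close>, whose arguments are always smaller variables, so nothing is
  captured.\<close>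

definition src_fo :: "nat \<Rightarrow> fo" where
  "src_fo x = Exists 20 (new_fo x 20)"

definition hop_fo :: fo where
  "hop_fo = Conj (src_fo 0) (Conj (src_fo 1)
     (Disj (Eq 0 1) (Exists 2 (Conj (new_fo 0 2) (old_reach_fo 2 1)))))"

definition mod_fo :: "nat \<Rightarrow> nat \<Rightarrow> nat \<Rightarrow> fo" where
  "mod_fo z m r = Conj (Conj (Leq r m) (Neg (Eq r m)))
     (Exists 20 (Exists 21 (Conj (Times 20 m 21) (Plus 21 r z))))"

text \<open>Rebinding the variables \<open>0\<close> and \<open>1\<close> applies the relation defined by \<open>\<phi>\<close> to other
  variables without substitution.\<close>

definition app_fo :: "fo \<Rightarrow> nat \<Rightarrow> nat \<Rightarrow> fo" where
  "app_fo \<phi> x y = Exists 0 (Exists 1 (Conj (Eq 0 x) (Conj (Eq 1 y) \<phi>)))"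

definition comp_fo :: "fo \<Rightarrow> fo" where
  "comp_fo \<phi> = Exists 2 (Exists 3 (Exists 4 (Conj (Conj (Eq 2 0) (Eq 3 1))
     (Conj (app_fo \<phi> 2 4) (app_fo \<phi> 4 3)))))"

text \<open>The variables \<open>2, \<dots>, 6\<close> stand for \<open>q, a, b, m, k\<close> in \<open>coded_step\<close>.\<close>

definition coded_inj_fo :: fo where
  "coded_inj_fo = Forall 7 (Forall 8 (Forall 9 (Imp
     (Conj (Conj (src_fo 7) (src_fo 8)) (Conj (mod_fo 7 2 9) (mod_fo 8 2 9))) (Eq 7 8))))"

definition coded_start_fo :: fo where
  "coded_start_fo = Exists 7 (Conj (mod_fo 0 2 7) (mod_fo 3 5 7))"

definition coded_end_fo :: fo where
  "coded_end_fo = Exists 7 (Exists 8 (Exists 9 (Conj (Conj (Times 6 4 7) (Plus 5 7 8))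
     (Conj (mod_fo 3 8 9) (mod_fo 1 2 9)))))"

text \<open>Variable \<open>7\<close> is the index \<open>i\<close>, \<open>9\<close> and
  \<open>10\<close> are the moduli at \<open>i\<close> and \<open>i + 1\<close>, \<open>11\<close>
  and \<open>12\<close> the names coded there, \<open>13\<close> and \<open>14\<close> the ends of
  the edge.\<close>

definition coded_edges_fo :: "fo \<Rightarrow> fo" where
  "coded_edges_fo \<phi> = Forall 7 (Imp (Conj (Leq 7 6) (Neg (Eq 7 6)))
     (Exists 8 (Exists 9 (Exists 10 (Exists 11 (Exists 12 (Exists 13 (Exists 14
       (Conj (Conj (Times 7 4 8) (Conj (Plus 5 8 9) (Plus 9 4 10)))
       (Conj (Conj (mod_fo 3 9 11) (mod_fo 3 10 12))
       (Conj (Conj (mod_fo 13 2 11) (mod_fo 14 2 12)) (app_fo \<phi> 13 14))))))))))))"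

definition coded_step_fo :: "fo \<Rightarrow> fo" where
  "coded_step_fo \<phi> = Conj (Conj (src_fo 0) (src_fo 1))
     (Exists 2 (Exists 3 (Exists 4 (Exists 5 (Exists 6
       (Conj (Conj coded_inj_fo coded_start_fo) (Conj coded_end_fo (coded_edges_fo \<phi>))))))))"

fun iter_fo :: "nat \<Rightarrow> fo" where
  "iter_fo 0 = hop_fo"
| "iter_fo (Suc d) = Disj (comp_fo (iter_fo d)) (coded_step_fo (iter_fo d))"

definition reach_fo :: "nat \<Rightarrow> fo" where
  "reach_fo d = Disj (old_reach_fo 0 1) (Exists 2 (Exists 3 (Exists 4
     (Conj (Conj (old_reach_fo 0 2) (app_fo (iter_fo d) 2 3))
       (Conj (new_fo 3 4) (old_reach_fo 4 1))))))"

section \<open>Free variables and well-formedness\<close>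

lemma free_vars_atoms [simp]:
  "free_vars (old_reach_fo x y) = {x, y}"
  "free_vars (new_fo x y) = {x, y}"
  "x \<noteq> 20 \<Longrightarrow> free_vars (src_fo x) = {x}"
  "\<lbrakk>z \<notin> {20, 21}; m \<notin> {20, 21}; r \<notin> {20, 21}\<rbrakk> \<Longrightarrow> free_vars (mod_fo z m r) = {z, m, r}"
  by (auto simp: old_reach_fo_def new_fo_def src_fo_def mod_fo_def)

lemma free_vars_app_fo:
  "\<lbrakk>free_vars \<phi> \<subseteq> {0, 1}; x \<notin> {0, 1}; y \<notin> {0, 1}\<rbrakk> \<Longrightarrow> free_vars (app_fo \<phi> x y) = {x, y}"
  by (auto simp: app_fo_def)

lemma free_vars_coded_step_fo:
  assumes "free_vars \<phi> \<subseteq> {0, 1}"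
  shows "free_vars (coded_step_fo \<phi>) = {0, 1}"
  by (simp add: coded_step_fo_def coded_inj_fo_def coded_start_fo_def coded_end_fo_def
      coded_edges_fo_def free_vars_app_fo[OF assms] insert_Diff_if insert_commute)

lemma free_vars_iter_fo: "free_vars (iter_fo d) \<subseteq> {0, 1}"
proof (induction d)
  case 0
  show ?case by (simp add: hop_fo_def insert_Diff_if)
next
  case (Suc d)
  then show ?case
    by (simp add: comp_fo_def free_vars_coded_step_fo free_vars_app_fo insert_Diff_if)
qed

lemma wf_atoms [simp]:
  "wf_fo [2] (old_reach_fo x y)" "wf_fo [2] (new_fo x y)" "wf_fo [2] (src_fo x)"
  "wf_fo ks (mod_fo z m r)" "wf_fo ks (app_fo \<phi> x y) \<longleftrightarrow> wf_fo ks \<phi>"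
  by (simp_all add: old_reach_fo_def new_fo_def src_fo_def mod_fo_def app_fo_def)

lemma wf_iter_fo: "wf_fo [2] (iter_fo d)"
  by (induction d) (simp_all add: hop_fo_def comp_fo_def coded_step_fo_def coded_inj_fo_def
      coded_start_fo_def coded_end_fo_def coded_edges_fo_def)

lemma reach_fo_wf: "wf_fo [2] (reach_fo d)" "free_vars (reach_fo d) \<subseteq> {..<2}"
  by (simp_all add: reach_fo_def wf_iter_fo free_vars_app_fo[OF free_vars_iter_fo] insert_Diff_if)

section \<open>Semantics of the formulas\<close>

lemma sat_old_reach_fo [simp]:
  "sat n E A v (old_reach_fo x y) \<longleftrightarrow> (v x, v y) \<in> old_reach A"
  by (auto simp: old_reach_fo_def old_reach_def)

lemma sat_new_fo [simp]:
  "sat n E A v (new_fo x y) \<longleftrightarrow> (v x, v y) \<in> E - old_reach A"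
  by (auto simp: new_fo_def)

lemma sat_src_fo [simp]:
  assumes "E \<subseteq> {..<n} \<times> {..<n}" "x \<noteq> 20"
  shows "sat n E A v (src_fo x) \<longleftrightarrow> v x \<in> Domain (E - old_reach A)"
  using assms by (auto simp: src_fo_def)

lemma sat_hop_fo:
  assumes "E \<subseteq> {..<n} \<times> {..<n}"
  shows "sat n E A v hop_fo \<longleftrightarrow> (v 0, v 1) \<in> hop (old_reach A) (E - old_reach A)"
  using assms by (auto simp: hop_fo_def hop_def)

text \<open>The exact meaning of \<open>mod_fo\<close>, including values \<open>z \<ge> n\<close>, so that it can be used as an
  unconditional rewrite rule.\<close>

definition has_rem :: "nat \<Rightarrow> nat \<Rightarrow> nat \<Rightarrow> nat \<Rightarrow> bool" where
  "has_rem n z m r \<longleftrightarrow> r < m \<and> (\<exists>t<n. t * m < n \<and> t * m + r = z)"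

lemma has_rem_iff:
  assumes "z < n" shows "has_rem n z m r \<longleftrightarrow> 0 < m \<and> z mod m = r"
proof
  assume r: "0 < m \<and> z mod m = r"
  have "z div m \<le> z" "z div m * m \<le> z" by (rule div_le_dividend, simp)
  then have "z div m < n" "z div m * m < n" using assms by linarith+
  moreover have "z div m * m + r = z" "r < m" using r by auto
  ultimately show "has_rem n z m r"
    unfolding has_rem_def by blast
qed (auto simp: has_rem_def)

lemma sat_mod_fo [simp]:
  assumes "z \<notin> {20, 21}" "m \<notin> {20, 21}" "r \<notin> {20, 21}"
  shows "sat n E A v (mod_fo z m r) \<longleftrightarrow> has_rem n (v z) (v m) (v r)"
  using assms by (auto simp: mod_fo_def has_rem_def)

lemma sat_app_fo:
  assumes \<phi>: "\<And>v. sat n E A v \<phi> \<longleftrightarrow> (v 0, v 1) \<in> R" and R: "R \<subseteq> {..<n} \<times> {..<n}"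
    and "x \<notin> {0, 1}" "y \<notin> {0, 1}"
  shows "sat n E A v (app_fo \<phi> x y) \<longleftrightarrow> (v x, v y) \<in> R"
  using assms(3,4) R by (auto simp: app_fo_def \<phi>)

lemma sat_comp_fo:
  assumes \<phi>: "\<And>v. sat n E A v \<phi> \<longleftrightarrow> (v 0, v 1) \<in> R" and R: "R \<subseteq> {..<n} \<times> {..<n}"
  shows "sat n E A v (comp_fo \<phi>) \<longleftrightarrow> (v 0, v 1) \<in> R O R"
  using R by (auto simp: comp_fo_def sat_app_fo[OF \<phi> R])

text \<open>Fact \<open>0\<close> transcribes the formula quantifier by quantifier;
  \<open>inj\<close>, \<open>rem\<close>, \<open>endp\<close> and \<open>edge\<close> turn its parts
  into the arithmetic of \<open>coded_step\<close>. Positivity of \<open>q\<close> and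
  \<open>m\<close> is implicit in the formula, as remainders exist only for positive moduli.\<close>

lemma sat_coded_step_fo:
  assumes \<phi>: "\<And>v. sat n E A v \<phi> \<longleftrightarrow> (v 0, v 1) \<in> R" and R: "R \<subseteq> {..<n} \<times> {..<n}"
    and E: "E \<subseteq> {..<n} \<times> {..<n}" and S: "S = Domain (E - old_reach A)"
  shows "sat n E A v (coded_step_fo \<phi>) \<longleftrightarrow> (v 0, v 1) \<in> coded_step n S R"
proof -
  have SV: "S \<subseteq> {..<n}" using E S by auto
  have 0: "sat n E A v (coded_step_fo \<phi>) \<longleftrightarrow> x \<in> S \<and> y \<in> S \<and>
    (\<exists>q<n. \<exists>a<n. \<exists>b<n. \<exists>m<n. \<exists>k<n.
      ((\<forall>u<n. \<forall>w<n. \<forall>r<n. (u \<in> S \<and> w \<in> S) \<and> has_rem n u q r \<and> has_rem n w q r \<longrightarrow> u = w) \<and>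
       (\<exists>r<n. has_rem n x q r \<and> has_rem n a m r)) \<and>
       (\<exists>p<n. \<exists>m'<n. \<exists>r<n. (k * b = p \<and> m + p = m') \<and> has_rem n a m' r \<and> has_rem n y q r) \<and>
       (\<forall>i<n. i \<le> k \<and> i \<noteq> k \<longrightarrow> (\<exists>p<n. \<exists>m1<n. \<exists>m2<n. \<exists>r<n. \<exists>r'<n. \<exists>u<n. \<exists>w<n.
          (i * b = p \<and> m + p = m1 \<and> m1 + b = m2) \<and> (has_rem n a m1 r \<and> has_rem n a m2 r') \<and>
          (has_rem n u q r \<and> has_rem n w q r') \<and> (u, w) \<in> R)))"
    if "v 0 = x" "v 1 = y" for x y
    unfolding coded_step_fo_def coded_inj_fo_def coded_start_fo_def coded_end_fo_def coded_edges_fo_def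
    using E that by (simp add: sat_app_fo[OF \<phi> R] S del: all_simps ex_simps)
  have inj: "(\<forall>u<n. \<forall>w<n. \<forall>r<n. (u \<in> S \<and> w \<in> S) \<and> has_rem n u q r \<and> has_rem n w q r \<longrightarrow> u = w) \<longleftrightarrow>
      inj_on (\<lambda>u. u mod q) S" if "0 < q" for q
    using SV that by (auto simp: inj_on_def has_rem_iff)
     (metis lessThan_iff mod_less_eq_dividend order_le_less_trans subsetD)
  have rem: "(\<exists>r<n. has_rem n a m r \<and> has_rem n x q r) \<longleftrightarrow> 0 < q \<and> 0 < m \<and> x mod q = a mod m"
    if "x < n" "a < n" for x a q m
    using that by (auto simp: has_rem_iff) (metis mod_less_eq_dividend order_le_less_trans)
  have rem': "(\<exists>r<n. has_rem n x q r \<and> has_rem n a m r) \<longleftrightarrow> 0 < q \<and> 0 < m \<and> x mod q = a mod m"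
    if "x < n" "a < n" for x a q m
    using rem[OF that] by (simp add: conj_commute)
  have endp: "(\<exists>p<n. \<exists>m'<n. \<exists>r<n. (k * b = p \<and> m + p = m') \<and> has_rem n a m' r \<and> has_rem n y q r) \<longleftrightarrow>
      m + k * b < n \<and> y mod q = a mod (m + k * b)"
    if "0 < q" "0 < m" "y < n" "a < n" for k b m a q y
  proof -
    have "(\<exists>p<n. \<exists>m'<n. \<exists>r<n. (k * b = p \<and> m + p = m') \<and> has_rem n a m' r \<and> has_rem n y q r) \<longleftrightarrow>
      m + k * b < n \<and> (\<exists>r<n. has_rem n a (m + k * b) r \<and> has_rem n y q r)"
      using add_lessD1[of "k * b" m n] by (metis add.commute)
    then show ?thesis using that rem by auto
  qed
  have edge: "(\<exists>p<n. \<exists>m1<n. \<exists>m2<n. \<exists>r<n. \<exists>r'<n. \<exists>u<n. \<exists>w<n.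
          (i * b = p \<and> m + p = m1 \<and> m1 + b = m2) \<and> (has_rem n a m1 r \<and> has_rem n a m2 r') \<and>
          (has_rem n u q r \<and> has_rem n w q r') \<and> (u, w) \<in> R) \<longleftrightarrow>
       (\<exists>u w. (u, w) \<in> R \<and> u mod q = a mod (m + i * b) \<and> w mod q = a mod (m + i * b + b))" (is "?L \<longleftrightarrow> ?Q")
    if "0 < q" "0 < m" "a < n" "m + k * b < n" "i < k" for i k b m a q
  proof -
    \<comment> \<open>The modulus at \<open>i + 1\<close> is at most the last one, so all
      intermediate values are in range.\<close>
    have "Suc i * b \<le> k * b" using that(5) by (intro mult_le_mono1) simp
    then have le: "m + i * b + b < n" using that(4) by simp
    then have "?L \<longleftrightarrow> (\<exists>u<n. \<exists>w<n. (u, w) \<in> R \<and>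
        (\<exists>r<n. has_rem n a (m + i * b) r \<and> has_rem n u q r) \<and>
        (\<exists>r'<n. has_rem n a (m + i * b + b) r' \<and> has_rem n w q r'))"
      (is "_ \<longleftrightarrow> ?M")
    proof -
      have ib: "i * b < n" "m + i * b < n" using le by linarith+
      show ?thesis
      proof
        assume ?M
        then obtain u w r r' where "u < n" "w < n" "r < n" "r' < n" "(u, w) \<in> R"
          "has_rem n a (m + i * b) r" "has_rem n u q r"
          "has_rem n a (m + i * b + b) r'" "has_rem n w q r'"
          by (elim exE conjE)
        then show ?L
          using ib le
          by (intro exI[of _ "i * b"] exI[of _ "m + i * b"] exI[of _ "m + i * b + b"]
            exI[of _ r] exI[of _ r'] exI[of _ u] exI[of _ w] conjI refl)
      next
        assume ?L
        then show ?M by (elim exE conjE) (intro exI conjI, assumption+, simp_all)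
      qed
    qed
    also have "\<dots> \<longleftrightarrow> (\<exists>u<n. \<exists>w<n. (u, w) \<in> R \<and> u mod q = a mod (m + i * b) \<and> w mod q = a mod (m + i * b + b))"
      using that by (simp add: rem cong: conj_cong)
    also have "\<dots> \<longleftrightarrow> ?Q" using R by blast
    finally show ?thesis .
  qed
  define x y where "x = v 0" and "y = v 1"
  show ?thesis
  proof (cases "x \<in> S \<and> y \<in> S")
    case True
    then have xy: "x < n" "y < n" using SV by auto
    have body: "((\<forall>u<n. \<forall>w<n. \<forall>r<n. (u \<in> S \<and> w \<in> S) \<and> has_rem n u q r \<and> has_rem n w q r \<longrightarrow> u = w) \<and>
       (\<exists>r<n. has_rem n x q r \<and> has_rem n a m r)) \<and>
       (\<exists>p<n. \<exists>m'<n. \<exists>r<n. (k * b = p \<and> m + p = m') \<and> has_rem n a m' r \<and> has_rem n y q r) \<and>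
       (\<forall>i<n. i \<le> k \<and> i \<noteq> k \<longrightarrow> (\<exists>p<n. \<exists>m1<n. \<exists>m2<n. \<exists>r<n. \<exists>r'<n. \<exists>u<n. \<exists>w<n.
          (i * b = p \<and> m + p = m1 \<and> m1 + b = m2) \<and> (has_rem n a m1 r \<and> has_rem n a m2 r') \<and>
          (has_rem n u q r \<and> has_rem n w q r') \<and> (u, w) \<in> R)) \<longleftrightarrow>
      0 < q \<and> inj_on (\<lambda>u. u mod q) S \<and> 0 < m \<and> m + k * b < n \<and>
        x mod q = a mod m \<and> y mod q = a mod (m + k * b) \<and>
        (\<forall>i<k. \<exists>u w. (u, w) \<in> R \<and>
           u mod q = a mod (m + i * b) \<and> w mod q = a mod (m + i * b + b))"
      (is "?lhs \<longleftrightarrow> ?rhs")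
      if "a < n" "k < n" for q a b m k
    \<comment> \<open>Otherwise both sides are false: the start condition rules out
      \<open>q = 0\<close> and \<open>m = 0\<close>, the end condition a last modulus outside the
      range of values.\<close>
    proof (cases "0 < q \<and> 0 < m \<and> m + k * b < n")
      case True
      then have pos: "0 < q" "0 < m" "m + k * b < n" by auto
      have "(i < n \<longrightarrow> i \<le> k \<and> i \<noteq> k \<longrightarrow> P) \<longleftrightarrow> (i < k \<longrightarrow> P)" for i P
        using that by auto
      then show ?thesis
        unfolding inj[OF pos(1)] rem'[OF xy(1) that(1)] endp[OF pos(1,2) xy(2) that(1)]
        using edge[OF pos(1,2) that(1) pos(3)] pos by (simp cong: imp_cong)
    next
      case False
      show ?thesis
      proof (cases "0 < q \<and> 0 < m")
        case True
        then have pos: "0 < q" "0 < m" by auto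
        show ?thesis
          unfolding endp[OF pos xy(2) that(1)] using False pos by argo
      next
        case False
        then show ?thesis
          unfolding rem'[OF xy(1) that(1)] by argo
      qed
    qed
    show ?thesis
      unfolding 0[OF x_def[symmetric] y_def[symmetric]]
      unfolding coded_step_def x_def[symmetric] y_def[symmetric] mem_Collect_eq prod.case
      by (simp only: body cong: conj_cong)
  next
    case False
    then show ?thesis
      unfolding 0[OF x_def[symmetric] y_def[symmetric]]
      by (auto simp: coded_step_def x_def y_def)
  qed
qed

lemma sat_iter_fo:
  assumes E: "E \<subseteq> {..<n} \<times> {..<n}"
  shows "sat n E A v (iter_fo d) \<longleftrightarrow> (v 0, v 1) \<in>
    iter_rel n (Domain (E - old_reach A)) (hop (old_reach A) (E - old_reach A)) d"
proof (induction d arbitrary: v)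
  case 0
  then show ?case using sat_hop_fo[OF E] by simp
next
  case (Suc d)
  let ?S = "Domain (E - old_reach A)"
  have "iter_rel n ?S (hop (old_reach A) (E - old_reach A)) d \<subseteq> ?S \<times> ?S"
    by (rule iter_rel_subset) (auto simp: hop_def)
  also have "\<dots> \<subseteq> {..<n} \<times> {..<n}" using E by auto
  finally have sub: "iter_rel n ?S (hop (old_reach A) (E - old_reach A)) d \<subseteq> {..<n} \<times> {..<n}" .
  show ?case
    using sat_comp_fo[OF Suc sub] sat_coded_step_fo[OF Suc sub E refl] by (simp add: Let_def)
qed

lemma sat_reach_fo:
  assumes E: "E \<subseteq> {..<n} \<times> {..<n}" and v: "v 0 < n" "v 1 < n"
  shows "sat n E A v (reach_fo d) \<longleftrightarrow> (v 0, v 1) \<in> old_reach A \<or>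
    (\<exists>u u' w. (v 0, u) \<in> old_reach A \<and>
       (u, u') \<in> iter_rel n (Domain (E - old_reach A)) (hop (old_reach A) (E - old_reach A)) d \<and>
       (u', w) \<in> E - old_reach A \<and> (w, v 1) \<in> old_reach A)"
proof -
  let ?S = "Domain (E - old_reach A)"
  let ?R = "iter_rel n ?S (hop (old_reach A) (E - old_reach A)) d"
  have "?R \<subseteq> ?S \<times> ?S"
    by (rule iter_rel_subset) (auto simp: hop_def)
  also have "\<dots> \<subseteq> {..<n} \<times> {..<n}" using E by auto
  finally have sub: "?R \<subseteq> {..<n} \<times> {..<n}" .
  have *: "sat n E A v (reach_fo d) \<longleftrightarrow> (v 0, v 1) \<in> old_reach A \<or>
    (\<exists>u<n. \<exists>u'<n. \<exists>w<n. ((v 0, u) \<in> old_reach A \<and> (u, u') \<in> ?R) \<and>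
       (u', w) \<in> E - old_reach A \<and> (w, v 1) \<in> old_reach A)"
    unfolding reach_fo_def
    by (simp add: sat_app_fo[OF sat_iter_fo[OF E] sub] del: ex_simps Diff_iff)
  show ?thesis unfolding * using E sub by blast
qed

section \<open>Constant depth suffices\<close>

text \<open>From the threshold \<open>N\<close> on, depth \<open>16 * c\<close> suffices by
  \<open>ex_code_length\<close>; below it, composition alone covers \<open>2 ^ d\<close> edges, and
  \<open>d \<ge> N\<^sup>2\<close> makes that enough. The maximum of both serves all
  \<open>n\<close>.\<close>

lemma ex_depth:
  fixes c :: nat
  shows "\<exists>d. \<forall>n S R. S \<subseteq> {..<n} \<longrightarrow> real (card S) \<le> log 2 (real n) ^ c \<longrightarrow>
    R \<subseteq> S \<times> S \<longrightarrow> Id_on S \<subseteq> R \<longrightarrow> R\<^sup>* \<inter> S \<times> S \<subseteq> iter_rel n S R d"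
proof -
  obtain N where N: "\<And>n. n \<ge> N \<Longrightarrow> \<exists>K\<ge>1. log 2 (real n) ^ (2 * c) \<le> real K ^ (16 * c) \<and>
    (\<forall>q. real q \<le> 2 * log 2 (real n) ^ (2 * c + 1) + 2 \<longrightarrow>
       (1 + (K + 1) * (fact K * q)) ^ (K + 1) < n)"
    using ex_code_length by blast
  define d where "d = max (16 * c) (N\<^sup>2)"
  show ?thesis
  proof (intro exI[of _ d] allI impI subrelI)
    fix n S R x y
    assume S: "S \<subseteq> {..<n}" and card: "real (card S) \<le> log 2 (real n) ^ c"
      and R: "R \<subseteq> S \<times> S" and refl: "Id_on S \<subseteq> R" and xy: "(x, y) \<in> R\<^sup>* \<inter> S \<times> S"
    have fin: "finite S" using S finite_subset by blast
    show "(x, y) \<in> iter_rel n S R d"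
    proof (cases "n < N")
      case True
      have "card S \<le> n" using card_mono[OF _ S] by simp
      then have "(card S)\<^sup>2 \<le> N\<^sup>2" using True by (intro power_mono) auto
      also have "\<dots> \<le> d" by (simp add: d_def)
      also have "\<dots> \<le> 2 ^ d" by (rule less_imp_le) (rule less_exp)
      finally have "(card S)\<^sup>2 \<le> 2 ^ d" .
      then show ?thesis
        using xy by (intro iter_rel_complete[OF _ R _ fin refl, of 2]) (auto simp: numeral_2_eq_2)
    next
      case False
      then obtain K where K: "1 \<le> K" and pow: "log 2 (real n) ^ (2 * c) \<le> real K ^ (16 * c)"
        and code: "\<And>q. real q \<le> 2 * log 2 (real n) ^ (2 * c + 1) + 2 \<Longrightarrow>
           (1 + (K + 1) * (fact K * q)) ^ (K + 1) < n"
        using N[of n] by auto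
      define l where "l = log 2 (real n)"
      have "S \<noteq> {}" using xy by auto
      then have n: "0 < n" using S by (cases n) auto
      then have l0: "0 \<le> l" and n_eq: "real n = 2 powr l" by (simp_all add: l_def)
      have card2: "real ((card S)\<^sup>2) \<le> l ^ (2 * c)"
        using power_mono[OF card, of 2] by (simp add: l_def power_mult mult.commute power_even_eq)
      have "l ^ (2 * c) \<le> real (K ^ (16 * c))" using pow by (simp add: l_def)
      also have "\<dots> \<le> real (K ^ d)"
        unfolding of_nat_le_iff using K by (intro power_increasing) (auto simp: d_def)
      finally have depth: "(card S)\<^sup>2 \<le> K ^ d" using card2 by linarith
      \<comment> \<open>Chosen to exceed
        \<open>log 2 (n ^ (card S)\<^sup>2) = l * (card S)\<^sup>2\<close> strictly but by at most
        1, so \<open>q \<le> 2 * M\<close> stays in the range allowed by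
        \<open>code\<close>.\<close>
      define M where "M = nat \<lfloor>l * real ((card S)\<^sup>2)\<rfloor> + 1"
      have M: "l * real ((card S)\<^sup>2) < real M" "real M \<le> l * real ((card S)\<^sup>2) + 1"
        unfolding M_def using l0 by (simp_all add: le_floor_iff) linarith
      have "real (n ^ (card S)\<^sup>2) = 2 powr (l * real ((card S)\<^sup>2))"
        unfolding of_nat_power n_eq
        using powr_realpow[of "2 powr l" "(card S)\<^sup>2"] by (simp add: powr_powr)
      also have "\<dots> < 2 powr real M" using M by simp
      also have "\<dots> = real (2 ^ M)" by (simp add: powr_realpow)
      finally have "n ^ (card S)\<^sup>2 < 2 ^ M" unfolding of_nat_less_iff .
      then obtain q where q: "0 < q" "q \<le> 2 * M" "inj_on (\<lambda>u. u mod q) S"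
        using ex_inj_on_mod[OF S] by blast
      have "real q \<le> 2 * real M" using q(2) by linarith
      also have "\<dots> \<le> 2 * (l * l ^ (2 * c)) + 2"
        using M(2) mult_left_mono[OF card2 l0] by linarith
      finally have "(1 + (K + 1) * (fact K * q)) ^ (K + 1) < n"
        using code[of q] by (simp add: l_def)
      then show ?thesis
        using xy coded_step_complete[OF S _ _ q(1,3)]
        by (intro iter_rel_complete[OF _ R K fin refl depth]) auto
    qed
  qed
qed

section \<open>The dynamic program\<close>

lemma run_snoc: "run n P (ds @ [x]) = step n P (run n P ds) x"
  by (simp add: run_def)

text \<open>Edges outside \<open>E\<^sup>*\<close> are inserted ones, so their sources number at
  most \<open>card (E' - E)\<close> and \<open>complete\<close> applies to them.\<close>

lemma update_reach:
  assumes E': "E' \<subseteq> {..<n} \<times> {..<n}" and old: "old_reach A = E\<^sup>*" and sub: "E \<subseteq> E'"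
    and complete: "\<And>S R. S \<subseteq> {..<n} \<Longrightarrow> card S \<le> card (E' - E) \<Longrightarrow>
      R \<subseteq> S \<times> S \<Longrightarrow> Id_on S \<subseteq> R \<Longrightarrow> R\<^sup>* \<inter> S \<times> S \<subseteq> iter_rel n S R d"
  shows "update_aux n [(2, reach_fo d)] E' A 0 = reachability n E'"
proof -
  define N where "N = E' - E\<^sup>*"
  let ?R = "hop (E\<^sup>*) N"
  have "finite E'" using E' finite_subset by blast
  then have "card (Domain N) \<le> card (E' - E)"
    unfolding N_def Domain_fst
    by (intro order_trans[OF card_image_le] card_mono) (auto simp: r_into_rtrancl)
  moreover have "Domain N \<subseteq> {..<n}" using E' by (auto simp: N_def)
  ultimately have compl: "?R\<^sup>* \<inter> Domain N \<times> Domain N \<subseteq> iter_rel n (Domain N) ?R d"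
    by (intro complete) (auto simp: hop_def)
  have sound: "iter_rel n (Domain N) ?R d \<subseteq> ?R\<^sup>*"
    by (rule iter_rel_sound) (auto simp: hop_def)
  have main: "sat n E' A v (reach_fo d) \<longleftrightarrow> (v 0, v 1) \<in> E'\<^sup>*" if v: "v 0 < n" "v 1 < n" for v
  proof -
    have "(u, u') \<in> iter_rel n (Domain N) ?R d" if "(u, u') \<in> ?R\<^sup>*" "(u', w) \<in> N" for u u' w
    proof -
      \<comment> \<open>On the empty path \<open>u = u'\<close> is the source of
        \<open>(u', w)\<close>; otherwise \<open>u\<close> starts a hop.\<close>
      have "u \<in> Domain N" using that by (cases rule: converse_rtranclE) (auto simp: hop_def)
      then show ?thesis using that compl by blast
    qed
    then have "sat n E' A v (reach_fo d) \<longleftrightarrow> (v 0, v 1) \<in> E\<^sup>* \<or>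
      (\<exists>u u' w. (v 0, u) \<in> E\<^sup>* \<and> (u, u') \<in> ?R\<^sup>* \<and> (u', w) \<in> N \<and> (w, v 1) \<in> E\<^sup>*)"
      unfolding sat_reach_fo[OF E' v] old N_def[symmetric] using sound by blast
    also have "\<dots> \<longleftrightarrow> (v 0, v 1) \<in> E'\<^sup>*"
      by (rule rtrancl_insertion_iff[symmetric]) (use sub in \<open>auto simp: N_def\<close>)
    finally show ?thesis .
  qed
  show ?thesis
  proof (intro set_eqI)
    fix a
    show "a \<in> update_aux n [(2, reach_fo d)] E' A 0 \<longleftrightarrow> a \<in> reachability n E'"
    proof (cases "\<exists>s t. a = [s, t]")
      case True
      then obtain s t where a: "a = [s, t]" by blast
      show ?thesis
        using main[of "\<lambda>x. a ! x"] by (auto simp: a update_aux_def reachability_def)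
    next
      case False
      then have "length a \<noteq> 2" by (auto simp: length_Suc_conv numeral_2_eq_2)
      then show ?thesis using False by (auto simp: update_aux_def reachability_def)
    qed
  qed
qed

lemma old_reach_reachability:
  assumes "E \<subseteq> {..<n} \<times> {..<n}" "A 0 = reachability n E"
  shows "old_reach A = E\<^sup>*"
proof -
  have "s < n \<and> t < n" if "(s, t) \<in> E\<^sup>*" "s \<noteq> t" for s t
    using that assms(1) by (metis converse_rtranclE lessThan_iff mem_Sigma_iff rtranclE subsetD)
  then show ?thesis using assms(2) by (auto simp: old_reach_def reachability_def)
qed

theorem theorem6:
  fixes c :: nat
  shows "(2, reachability) \<in> DynFO (insertions (\<lambda>n. log 2 (real n) ^ c))"
proof -
  obtain d where d: "\<And>n S R. S \<subseteq> {..<n} \<Longrightarrow> real (card S) \<le> log 2 (real n) ^ c \<Longrightarrow>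
    R \<subseteq> S \<times> S \<Longrightarrow> Id_on S \<subseteq> R \<Longrightarrow> R\<^sup>* \<inter> S \<times> S \<subseteq> iter_rel n S R d"
    using ex_depth[of c] by blast
  define P where "P = [(2 :: nat, reach_fo d)]"
  \<comment> \<open>Relation \<open>0\<close> is empty before the first change although every node
    reaches itself, so the induction rests on \<open>old_reach\<close>, which is correct from the
    start.\<close>
  have inv: "fst (run n P ds) \<subseteq> {..<n} \<times> {..<n} \<and>
      old_reach (snd (run n P ds)) = (fst (run n P ds))\<^sup>* \<and>
      (ds \<noteq> [] \<longrightarrow> snd (run n P ds) 0 = reachability n (fst (run n P ds)))"
    if "set ds \<subseteq> insertions (\<lambda>n. log 2 (real n) ^ c) n" for n ds
    using that
  proof (induction ds rule: rev_induct)
    case Nil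
    then show ?case by (auto simp: run_def old_reach_def)
  next
    case (snoc x ds)
    obtain E A where EA: "run n P ds = (E, A)" by fastforce
    obtain X where x: "x = Insert X" and X: "X \<subseteq> {..<n} \<times> {..<n}" "real (card X) \<le> log 2 (real n) ^ c"
      using snoc.prems by (auto simp: insertions_def)
    have IH: "E \<subseteq> {..<n} \<times> {..<n}" "old_reach A = E\<^sup>*" using snoc EA by auto
    have E': "E \<union> X \<subseteq> {..<n} \<times> {..<n}" using IH X by auto
    have "finite X" using X finite_subset by blast
    then have "card (E \<union> X - E) \<le> card X" by (intro card_mono) auto
    then have "update_aux n P (E \<union> X) A 0 = reachability n (E \<union> X)"
      unfolding P_def using X(2) by (intro update_reach[OF E' IH(2)] d) auto
    then show ?case
      using E' old_reach_reachability[OF E'] by (simp add: run_snoc EA x Let_def)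
  qed
  have "\<forall>n ds. ds \<noteq> [] \<and> set ds \<subseteq> insertions (\<lambda>n. log 2 (real n) ^ c) n \<longrightarrow>
      (case run n P ds of (E, A) \<Rightarrow> A 0 = reachability n E)"
    using inv by (simp add: case_prod_beta)
  moreover have "wf_program P"
    using reach_fo_wf[of d] by (simp add: wf_program_def P_def)
  moreover have "0 < length P" "fst (P ! 0) = 2" by (simp_all add: P_def)
  ultimately show ?thesis
    unfolding DynFO_def mem_Collect_eq prod.case by (intro exI[of _ P] exI[of _ 0] conjI)
qed

end
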